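(* For every $q\in(1/2,1)$ there exists a $2$-action partial monitoring game (with countably infinite latent space $\mathcal Z$) such that, in the standard setting, $$\lim_{n\to\infty}\frac{\log(\mathfrak R_n^\star)}{\log(n)}=q.$$
   Context: A $k$-action partial monitoring game: set $\mathcal Z$, loss $\mathcal L:[k]\times\mathcal Z\to[0,1]$, signal $\mathcal S:[k]\times\mathcal Z\to\Sigma$. $\mathcal K$ = finitely supported probability distributions on $\mathcal Z$; $\mathcal L(a,x)=\sum_zx(z)\mathcal L(a,z)$. Standard setting: interaction over $n$ rounds where an adversary fixes $x_1,\dots,x_n\in\mathcal K$, $z_t\sim x_t$ independently and unobserved; the learner chooses $a_t$ (possibly randomised) based on $a_1,\sigma_1,\dots,a_{t-1},\sigma_{t-1}$ and observes $\sigma_t=\mathcal S(a_t,z_t)$; regret $\mathbb E[\sum_t\mathcal L(a_t,x_t)]-n\min_{a}\mathcal L(a,\frac1n\sum_tx_t)$; $\mathfrak R_n^\star$ = infimum over learners of the supremum over adversary sequences of the regret. *)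

theory Defs
  imports "HOL-Probability.Probability"
begin

text \<open>Two-action partial monitoring games with latent space Z = nat (countably infinite),
  actions = bool (two actions), signals in nat.
  A game is given by a loss L :: bool => nat => real and a signal S :: bool => nat => nat.\<close>

type_synonym learner = "(bool \<times> nat) list \<Rightarrow> bool pmf"

definition exp_loss :: "(bool \<Rightarrow> nat \<Rightarrow> real) \<Rightarrow> bool \<Rightarrow> nat pmf \<Rightarrow> real" where
  "exp_loss L a x = measure_pmf.expectation x (L a)"

fun history :: "(bool \<Rightarrow> nat \<Rightarrow> nat) \<Rightarrow> learner \<Rightarrow> (nat \<Rightarrow> nat pmf) \<Rightarrow> nat
                 \<Rightarrow> (bool \<times> nat) list pmf" where
  "history S \<pi> x 0 = return_pmf []"
| "history S \<pi> x (Suc t) =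
     bind_pmf (history S \<pi> x t) (\<lambda>h.
     bind_pmf (\<pi> h) (\<lambda>a.
     bind_pmf (x t) (\<lambda>z. return_pmf (h @ [(a, S a z)]))))"

definition avg_dist :: "nat \<Rightarrow> (nat \<Rightarrow> nat pmf) \<Rightarrow> nat pmf" where
  "avg_dist n x = bind_pmf (pmf_of_set {..<n}) x"

definition regret :: "(bool \<Rightarrow> nat \<Rightarrow> real) \<Rightarrow> (bool \<Rightarrow> nat \<Rightarrow> nat) \<Rightarrow> nat
                      \<Rightarrow> learner \<Rightarrow> (nat \<Rightarrow> nat pmf) \<Rightarrow> real" where
  "regret L S n \<pi> x =
     measure_pmf.expectation (history S \<pi> x n)
        (\<lambda>h. \<Sum>t<n. exp_loss L (fst (h ! t)) (x t))
     - real n * (MIN a. exp_loss L a (avg_dist n x))"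

definition adversaries :: "nat \<Rightarrow> (nat \<Rightarrow> nat pmf) set" where
  "adversaries n = {x. \<forall>t<n. finite (set_pmf (x t))}"

definition minimax_regret :: "(bool \<Rightarrow> nat \<Rightarrow> real) \<Rightarrow> (bool \<Rightarrow> nat \<Rightarrow> nat) \<Rightarrow> nat \<Rightarrow> real" where
  "minimax_regret L S n = (INF \<pi>. SUP x\<in>adversaries n. regret L S n \<pi> x)"

end

theory Submission
  imports Defs
begin

text \<open>
  Put \<open>F i = i powr g\<close> with \<open>g = 2 * q - 1\<close>. An outcome is an edge between the levels \<open>i\<close> and
  \<open>i + 1\<close> together with the action sitting on the upper end; the learner sees the level of
  the chosen action, and that action loses \<open>F (i + 1) - F i\<close> if it is the upper one. Up to a shift common
  to both actions, the loss is the unbounded function \<open>F\<close> of the signal.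

  Upper bound: truncating \<open>F\<close> at level \<open>k\<close> changes loss differences by at most
  \<open>k powr (g - 1)\<close>, and the truncated game is an adversarial bandit with range \<open>k powr g\<close>. Exp3 with
  \<open>k\<close> of order \<open>sqrt n\<close> therefore has regret of order
  \<open>n * k powr (g - 1) + sqrt n * k powr g\<close>, which is of order \<open>n powr q\<close>.

  Lower bound: on the first \<open>m\<close> edges, let the probability that a given action is the upper one be
  tilted by a tent-shaped amount. The actions then differ in loss by order \<open>m powr (g - 1)\<close>, whereas
  exchanging the two actions changes the signal distributions by a relative amount \<open>1 / m\<close> only, so that
  \<open>n\<close> rounds with \<open>m\<close> of order \<open>sqrt n\<close> do not separate the two environments. This is
  measured by the Bhattacharyya coefficient, which is multiplicative over the rounds of an interaction.
\<close>

subsection \<open>Histories and regret\<close>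

lemma expectation_bind_finite:
  fixes g :: "'b \<Rightarrow> real"
  assumes "finite (set_pmf p)" "\<And>y. y \<in> set_pmf p \<Longrightarrow> finite (set_pmf (f y))"
  shows "measure_pmf.expectation (bind_pmf p f) g
           = measure_pmf.expectation p (\<lambda>y. measure_pmf.expectation (f y) g)"
  using assms by (subst pmf_expectation_bind[of "set_pmf p"])
    (auto simp: integral_measure_pmf[of "set_pmf p"])

lemma expectation_mono_finite:
  fixes f g :: "'a \<Rightarrow> real"
  assumes "finite (set_pmf p)" "\<And>y. y \<in> set_pmf p \<Longrightarrow> f y \<le> g y"
  shows "measure_pmf.expectation p f \<le> measure_pmf.expectation p g"
  using assms by (intro integral_mono_AE integrable_measure_pmf_finite AE_pmfI)

lemma finite_set_history:
  assumes "x \<in> adversaries n" "t \<le> n"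
  shows "finite (set_pmf (history S \<pi> x t))"
  using assms(2)
proof (induction t)
  case (Suc t)
  moreover have "finite (set_pmf (x t))"
    using assms(1) Suc.prems by (auto simp: adversaries_def)
  moreover have "finite (set_pmf (\<pi> h))" for h
    by (rule finite_subset[OF subset_UNIV]) simp
  ultimately show ?case
    by (auto simp: set_bind_pmf)
qed simp

lemma length_history: "h \<in> set_pmf (history S \<pi> x t) \<Longrightarrow> length h = t"
  by (induction t arbitrary: h) (auto simp: set_bind_pmf)

text \<open>Given the history, outcome and action are independent, so the action may be averaged
  with the outcome held fixed, as the analysis of Exp3 requires.\<close>

lemma expectation_history_Suc:
  fixes f :: "(bool \<times> nat) list \<Rightarrow> real"
  assumes "x \<in> adversaries n" "t < n"
  shows "measure_pmf.expectation (history S \<pi> x (Suc t)) f =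
    measure_pmf.expectation (history S \<pi> x t) (\<lambda>h.
      measure_pmf.expectation (x t) (\<lambda>z.
        measure_pmf.expectation (\<pi> h) (\<lambda>a. f (h @ [(a, S a z)]))))"
proof -
  have fx: "finite (set_pmf (x t))"
    using assms by (auto simp: adversaries_def)
  have f\<pi>: "finite (set_pmf (\<pi> h))" for h
    by (rule finite_subset[OF subset_UNIV]) simp
  have fh: "finite (set_pmf (history S \<pi> x t))"
    using assms by (intro finite_set_history[of _ n]) auto
  have "history S \<pi> x (Suc t) =
     bind_pmf (history S \<pi> x t) (\<lambda>h. bind_pmf (x t) (\<lambda>z.
     bind_pmf (\<pi> h) (\<lambda>a. return_pmf (h @ [(a, S a z)]))))"
    by (simp, subst bind_commute_pmf) simp
  then show ?thesis
    by (simp only:) (simp add: expectation_bind_finite fx f\<pi> fh set_bind_pmf)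
qed

lemma exp_loss_avg_dist:
  assumes "x \<in> adversaries n" "n > 0"
  shows "real n * exp_loss L a (avg_dist n x) = (\<Sum>t<n. exp_loss L a (x t))"
  using assms unfolding exp_loss_def avg_dist_def
  by (subst pmf_expectation_bind_pmf_of_set)
    (auto simp: adversaries_def lessThan_empty_iff sum_distrib_left intro!: sum.cong)

lemma regret_ge:
  assumes "x \<in> adversaries n" "n > 0"
  shows "measure_pmf.expectation (history S \<pi> x n)
      (\<lambda>h. \<Sum>t<n. exp_loss L (fst (h ! t)) (x t) - exp_loss L b (x t)) \<le> regret L S n \<pi> x"
proof -
  have "real n * (MIN a. exp_loss L a (avg_dist n x)) \<le> real n * exp_loss L b (avg_dist n x)"
    by (intro mult_left_mono) auto
  then show ?thesis
    using assms
    by (simp add: regret_def exp_loss_avg_dist sum_subtractf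
          Bochner_Integration.integral_diff integrable_measure_pmf_finite finite_set_history)
qed

text \<open>The minimum is attained by some action. Upper bounds need such an exact comparator,
  while lower bounds may use any.\<close>

lemma regret_eq:
  assumes "x \<in> adversaries n" "n > 0"
  obtains b where "regret L S n \<pi> x = measure_pmf.expectation (history S \<pi> x n)
      (\<lambda>h. \<Sum>t<n. exp_loss L (fst (h ! t)) (x t) - exp_loss L b (x t))"
proof -
  have "(MIN a. exp_loss L a (avg_dist n x)) \<in> range (\<lambda>a. exp_loss L a (avg_dist n x))"
    by (intro Min_in) auto
  then obtain b where "(MIN a. exp_loss L a (avg_dist n x)) = exp_loss L b (avg_dist n x)"
    by blast
  then show ?thesis
    using assms
    by (intro that[of b]) (simp add: regret_def exp_loss_avg_dist sum_subtractf
          Bochner_Integration.integral_diff integrable_measure_pmf_finite finite_set_history)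
qed

lemma exp_loss_bounds:
  assumes "\<And>a z. 0 \<le> L a z \<and> L a z \<le> 1"
  shows "0 \<le> exp_loss L a x" "exp_loss L a x \<le> 1"
proof -
  show "0 \<le> exp_loss L a x"
    unfolding exp_loss_def using assms by (intro Bochner_Integration.integral_nonneg) auto
  have "integrable (measure_pmf x) (L a)"
    using assms by (intro measure_pmf.integrable_const_bound[where B=1]) auto
  then show "exp_loss L a x \<le> 1"
    unfolding exp_loss_def using assms by (intro measure_pmf.integral_le_const) auto
qed

text \<open>Real suprema and infima are informative only on bounded sets; this supplies the
  boundedness.\<close>

lemma abs_regret_le:
  assumes L: "\<And>a z. 0 \<le> L a z \<and> L a z \<le> 1" and x: "x \<in> adversaries n" and n: "n > 0"
  shows "\<bar>regret L S n \<pi> x\<bar> \<le> real n"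
proof -
  obtain b where b: "regret L S n \<pi> x = measure_pmf.expectation (history S \<pi> x n)
      (\<lambda>h. \<Sum>t<n. exp_loss L (fst (h ! t)) (x t) - exp_loss L b (x t))"
    using regret_eq[OF x n] .
  have *: "\<bar>\<Sum>t<n. exp_loss L (fst (h ! t)) (x t) - exp_loss L b (x t)\<bar> \<le> real n"
    for h :: "(bool \<times> nat) list"
  proof -
    have "\<bar>exp_loss L c y - exp_loss L d y\<bar> \<le> 1" for c d y
      using exp_loss_bounds[of L, OF L] by (smt (verit))
    then have "(\<Sum>t<n. \<bar>exp_loss L (fst (h ! t)) (x t) - exp_loss L b (x t)\<bar>) \<le> (\<Sum>t<n. 1)"
      by (intro sum_mono) auto
    then show ?thesis
      by (intro order_trans[OF sum_abs]) simp
  qed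
  have fin: "finite (set_pmf (history S \<pi> x n))"
    using x by (rule finite_set_history) simp
  have "regret L S n \<pi> x \<le> measure_pmf.expectation (history S \<pi> x n) (\<lambda>_. real n)"
    unfolding b using fin * by (intro expectation_mono_finite) (auto simp: abs_le_iff)
  moreover have "measure_pmf.expectation (history S \<pi> x n) (\<lambda>_. - real n) \<le> regret L S n \<pi> x"
    unfolding b using fin *
    by (intro expectation_mono_finite) (auto simp: abs_le_iff minus_le_iff)
  ultimately show ?thesis
    by simp
qed

lemma return_in_adversaries: "(\<lambda>_. return_pmf 0) \<in> adversaries n"
  by (simp add: adversaries_def)

lemma bdd_above_regret:
  assumes "\<And>a z. 0 \<le> L a z \<and> L a z \<le> 1" "n > 0"
  shows "bdd_above (regret L S n \<pi> ` adversaries n)"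
proof (rule bdd_aboveI2)
  show "regret L S n \<pi> x \<le> real n" if "x \<in> adversaries n" for x
    using abs_regret_le[of L, OF assms(1) that assms(2)] by (simp add: abs_le_iff)
qed

lemma minimax_regret_le:
  assumes L: "\<And>a z. 0 \<le> L a z \<and> L a z \<le> 1" and n: "n > 0"
    and "\<And>x. x \<in> adversaries n \<Longrightarrow> regret L S n \<pi> x \<le> r"
  shows "minimax_regret L S n \<le> r"
  unfolding minimax_regret_def
proof (rule cINF_lower2[of _ _ \<pi>])
  show "bdd_below (range (\<lambda>\<pi>. SUP x\<in>adversaries n. regret L S n \<pi> x))"
  proof (rule bdd_belowI2)
    fix \<pi>
    \<comment> \<open>One fixed adversary, the constant outcome 0, already keeps the worst case of
      every learner above \<open>- n\<close>.\<close>
    have "- real n \<le> regret L S n \<pi> (\<lambda>_. return_pmf 0)"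
      using abs_regret_le[of L, OF L return_in_adversaries n] by (simp add: abs_le_iff minus_le_iff)
    also have "\<dots> \<le> (SUP x\<in>adversaries n. regret L S n \<pi> x)"
      by (intro cSUP_upper return_in_adversaries bdd_above_regret L n)
    finally show "- real n \<le> (SUP x\<in>adversaries n. regret L S n \<pi> x)" .
  qed
  show "(SUP x\<in>adversaries n. regret L S n \<pi> x) \<le> r"
    using assms(3) return_in_adversaries by (intro cSUP_least) auto
qed simp

lemma minimax_regret_ge:
  assumes L: "\<And>a z. 0 \<le> L a z \<and> L a z \<le> 1" and n: "n > 0"
    and "\<And>\<pi>. \<exists>x\<in>adversaries n. r \<le> regret L S n \<pi> x"
  shows "r \<le> minimax_regret L S n"
  unfolding minimax_regret_def
proof (rule cINF_greatest)
  fix \<pi>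
  obtain x where "x \<in> adversaries n" "r \<le> regret L S n \<pi> x"
    using assms(3) by blast
  then show "r \<le> (SUP x\<in>adversaries n. regret L S n \<pi> x)"
    by (intro cSUP_upper2 bdd_above_regret L n)
qed simp

subsection \<open>Exp3\<close>

definition exp3_prob :: "real \<Rightarrow> (bool \<Rightarrow> real) \<Rightarrow> bool \<Rightarrow> real" where
  "exp3_prob \<eta> G a = exp (- \<eta> * G a) / (exp (- \<eta> * G False) + exp (- \<eta> * G True))"

text \<open>Here \<open>l\<close> maps a signal to the loss fed to the algorithm.\<close>

definition exp3_update :: "real \<Rightarrow> (nat \<Rightarrow> real) \<Rightarrow> (bool \<Rightarrow> real) \<Rightarrow> bool \<times> nat \<Rightarrow> (bool \<Rightarrow> real)" where
  "exp3_update \<eta> l G y = G(fst y := G (fst y) + l (snd y) / exp3_prob \<eta> G (fst y))"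

definition exp3_state :: "real \<Rightarrow> (nat \<Rightarrow> real) \<Rightarrow> (bool \<times> nat) list \<Rightarrow> (bool \<Rightarrow> real)" where
  "exp3_state \<eta> l = foldl (exp3_update \<eta> l) (\<lambda>_. 0)"

definition exp3 :: "real \<Rightarrow> (nat \<Rightarrow> real) \<Rightarrow> learner" where
  "exp3 \<eta> l h = bernoulli_pmf (exp3_prob \<eta> (exp3_state \<eta> l h) True)"

text \<open>This is \<open>- ln (exp3_prob \<eta> G b)\<close>, the log of the total weight relative
  to that of the comparator \<open>b\<close>.\<close>

definition exp3_potential :: "real \<Rightarrow> bool \<Rightarrow> (bool \<Rightarrow> real) \<Rightarrow> real" where
  "exp3_potential \<eta> b G = ln (exp (- \<eta> * G False) + exp (- \<eta> * G True)) + \<eta> * G b"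

lemma exp3_prob_bounds:
  "0 < exp3_prob \<eta> G a" "exp3_prob \<eta> G a < 1"
  "exp3_prob \<eta> G False = 1 - exp3_prob \<eta> G True"
proof -
  have "0 < exp (- \<eta> * G False) + exp (- \<eta> * G True)"
    by (simp add: add_pos_pos)
  then show "0 < exp3_prob \<eta> G a" "exp3_prob \<eta> G a < 1"
    "exp3_prob \<eta> G False = 1 - exp3_prob \<eta> G True"
    by (cases a; simp add: exp3_prob_def field_simps)+
qed

lemma exp3_potential_nonneg: "0 \<le> exp3_potential \<eta> b G"
proof -
  have "ln (exp (- \<eta> * G b)) \<le> ln (exp (- \<eta> * G False) + exp (- \<eta> * G True))"
    by (subst ln_le_cancel_iff) (cases b; simp add: add_pos_pos)+
  then show ?thesis
    by (simp add: exp3_potential_def)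
qed

text \<open>The cubic Lagrange remainder is nonpositive. Validity for all \<open>y \<ge> 0\<close>
  matters because importance-weighted losses can be arbitrarily large.\<close>

lemma exp_minus_le_quadratic:
  fixes y :: real
  assumes "0 \<le> y"
  shows "exp (- y) \<le> 1 - y + y\<^sup>2 / 2"
proof (cases "y = 0")
  case False
  then obtain t where "exp (- y) = (\<Sum>m<3. (- y) ^ m / fact m) + exp t / fact 3 * (- y) ^ 3"
    using Maclaurin_exp_le[of "-y" 3] by auto
  moreover have "exp t / fact 3 * (- y) ^ 3 \<le> 0"
    using assms by (intro mult_nonneg_nonpos) (auto simp: power3_eq_cube mult_nonpos_nonneg)
  ultimately show ?thesis
    by (simp add: eval_nat_numeral)
qed simp

text \<open>Only the weight of the played action changes, so the total is multiplied by
  \<open>1 + p * (exp (- (\<eta> * u / p)) - 1)\<close>. After \<open>ln x \<le> x - 1\<close> and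
  the quadratic bound, the factor \<open>p\<close> cancels one of the two factors
  \<open>1 / p\<close> in the square.\<close>

lemma ln_weight_update_le:
  fixes \<eta> u :: real
  assumes "0 < \<eta>" "0 \<le> u"
  shows "ln (exp (- \<eta> * (G(a := G a + u / exp3_prob \<eta> G a)) False)
             + exp (- \<eta> * (G(a := G a + u / exp3_prob \<eta> G a)) True))
         \<le> ln (exp (- \<eta> * G False) + exp (- \<eta> * G True)) - \<eta> * u + \<eta>\<^sup>2 * u\<^sup>2 / (2 * exp3_prob \<eta> G a)"
    (is "ln ?W' \<le> ln ?W - _ + _")
proof -
  define p where "p = exp3_prob \<eta> G a"
  have p: "0 < p" "p < 1" unfolding p_def by (rule exp3_prob_bounds)+
  have W: "0 < ?W" by (simp add: add_pos_pos)
  have pW: "p * ?W = exp (- \<eta> * G a)"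
    using W by (simp add: p_def exp3_prob_def)
  have "?W' = ?W + (exp (- \<eta> * (G a + u / p)) - exp (- \<eta> * G a))"
    by (cases a) (simp_all add: p_def)
  also have "exp (- \<eta> * (G a + u / p)) = exp (- \<eta> * G a) * exp (- (\<eta> * u / p))"
    by (simp add: exp_add[symmetric] algebra_simps)
  also have "?W + (exp (- \<eta> * G a) * exp (- (\<eta> * u / p)) - exp (- \<eta> * G a))
      = ?W + exp (- \<eta> * G a) * (exp (- (\<eta> * u / p)) - 1)"
    by (simp add: algebra_simps)
  also have "\<dots> = ?W * (1 + p * (exp (- (\<eta> * u / p)) - 1))"
    unfolding pW[symmetric] by (simp add: algebra_simps)
  finally have W': "?W' = ?W * (1 + p * (exp (- (\<eta> * u / p)) - 1))" .
  have "0 < ?W'" by (simp add: add_pos_pos)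
  then have pos: "0 < 1 + p * (exp (- (\<eta> * u / p)) - 1)"
    using W unfolding W' by (simp only: zero_less_mult_iff) linarith
  have "ln ?W' = ln ?W + ln (1 + p * (exp (- (\<eta> * u / p)) - 1))"
    unfolding W' using W pos by (intro ln_mult_pos)
  also have "ln (1 + p * (exp (- (\<eta> * u / p)) - 1)) \<le> p * (exp (- (\<eta> * u / p)) - 1)"
    using ln_le_minus_one[OF pos] by simp
  also have "\<dots> \<le> p * (- (\<eta> * u / p) + (\<eta> * u / p)\<^sup>2 / 2)"
    using exp_minus_le_quadratic[of "\<eta> * u / p"] assms p by (intro mult_left_mono) auto
  also have "\<dots> = - \<eta> * u + \<eta>\<^sup>2 * u\<^sup>2 / (2 * p)"
    using p by (simp add: field_simps power2_eq_square)
  finally show ?thesis by (simp add: p_def)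
qed

text \<open>Averaging over the played action makes the importance-weighted estimates unbiased and
  turns the second-order terms into \<open>(u a)\<^sup>2 / 2\<close>, together at most
  \<open>B\<^sup>2\<close>.\<close>

lemma exp3_potential_step:
  fixes u G :: "bool \<Rightarrow> real" and \<eta> B :: real
  assumes "0 < \<eta>" "\<And>a. 0 \<le> u a" "\<And>a. u a \<le> B"
  defines "p \<equiv> exp3_prob \<eta> G True"
  defines "G' \<equiv> \<lambda>a. G(a := G a + u a / exp3_prob \<eta> G a)"
  shows "exp3_potential \<eta> b (G' True) * p + exp3_potential \<eta> b (G' False) * (1 - p)
    \<le> exp3_potential \<eta> b G - \<eta> * (u True * p + u False * (1 - p) - u b) + \<eta>\<^sup>2 * B\<^sup>2"
proof -
  define W where "W = ln (exp (- \<eta> * G False) + exp (- \<eta> * G True))"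
  have p: "0 < p" "p < 1" unfolding p_def by (rule exp3_prob_bounds)+
  have pF: "exp3_prob \<eta> G False = 1 - p" unfolding p_def by (rule exp3_prob_bounds)
  have sq: "(u a)\<^sup>2 \<le> B\<^sup>2" for a
    using assms by (intro power_mono)
  have T: "exp3_potential \<eta> b (G' True) * p
      \<le> (W - \<eta> * u True + \<eta>\<^sup>2 * (u True)\<^sup>2 / (2 * p) + \<eta> * G' True b) * p"
    using ln_weight_update_le[of \<eta> "u True" G True] assms(1,2) p
    by (intro mult_right_mono) (auto simp: exp3_potential_def G'_def W_def p_def[symmetric])
  have F: "exp3_potential \<eta> b (G' False) * (1 - p)
      \<le> (W - \<eta> * u False + \<eta>\<^sup>2 * (u False)\<^sup>2 / (2 * (1 - p)) + \<eta> * G' False b) * (1 - p)"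
    using ln_weight_update_le[of \<eta> "u False" G False] assms(1,2) p
    by (intro mult_right_mono) (auto simp: exp3_potential_def G'_def W_def pF)
  have Gb: "G' True b * p + G' False b * (1 - p) = G b + u b"
    using p by (cases b) (auto simp: G'_def pF p_def[symmetric] field_simps)
  have "exp3_potential \<eta> b (G' True) * p + exp3_potential \<eta> b (G' False) * (1 - p) \<le>
     W - \<eta> * (u True * p + u False * (1 - p)) + \<eta>\<^sup>2 * ((u True)\<^sup>2 + (u False)\<^sup>2) / 2
       + \<eta> * (G' True b * p + G' False b * (1 - p))"
  proof -
    have cancel: "(W - \<eta> * v + \<eta>\<^sup>2 * v\<^sup>2 / (2 * r) + \<eta> * g) * r
        = W * r - \<eta> * v * r + \<eta>\<^sup>2 * v\<^sup>2 / 2 + \<eta> * g * r" if "r \<noteq> 0" for v g r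
      using that by (simp add: field_simps)
    show ?thesis
      using add_mono[OF T[unfolded cancel[OF p(1)[THEN less_imp_neq, THEN not_sym]]]
          F[unfolded cancel[OF diff_gt_0_iff_gt[THEN iffD2, OF p(2), THEN less_imp_neq, THEN not_sym]]]]
      by (simp add: algebra_simps add_divide_distrib)
  qed
  also have "\<dots> = W + \<eta> * G b - \<eta> * (u True * p + u False * (1 - p) - u b)
       + \<eta>\<^sup>2 * (((u True)\<^sup>2 + (u False)\<^sup>2) / 2)"
    unfolding Gb by (simp add: algebra_simps)
  also have "\<dots> \<le> W + \<eta> * G b - \<eta> * (u True * p + u False * (1 - p) - u b) + \<eta>\<^sup>2 * B\<^sup>2"
    using sq[of True] sq[of False] by (intro add_mono mult_left_mono) auto
  finally show ?thesis by (simp add: W_def exp3_potential_def)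
qed

text \<open>The error \<open>\<epsilon>\<close> allows for surrogate losses that match the true loss differences only approximately.\<close>

lemma exp3_potential_history:
  assumes \<eta>: "0 < \<eta>" and l: "\<And>s. 0 \<le> l s" "\<And>s. l s \<le> B"
    and \<epsilon>: "\<And>a z. \<bar>(L a z - L b z) - (l (S a z) - l (S b z))\<bar> \<le> \<epsilon>"
    and x: "x \<in> adversaries n" and "t \<le> n"
  shows "measure_pmf.expectation (history S (exp3 \<eta> l) x t)
      (\<lambda>h. exp3_potential \<eta> b (exp3_state \<eta> l h)
        + \<eta> * (\<Sum>s<t. exp_loss L (fst (h ! s)) (x s) - exp_loss L b (x s)))
    \<le> ln 2 + real t * (\<eta> * (\<epsilon> + \<eta> * B\<^sup>2))"
  using \<open>t \<le> n\<close>
proof (induction t)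
  case 0
  then show ?case by (simp add: exp3_potential_def exp3_state_def)
next
  case (Suc t)
  define H where "H = history S (exp3 \<eta> l) x t"
  define V where "V t h = (\<Sum>s<t. exp_loss L (fst (h ! s)) (x s) - exp_loss L b (x s))"
    for t and h :: "(bool \<times> nat) list"
  define \<Phi> where "\<Phi> h = exp3_potential \<eta> b (exp3_state \<eta> l h)" for h
  define c where "c = \<eta> * (\<epsilon> + \<eta> * B\<^sup>2)"
  have fH: "finite (set_pmf H)"
    unfolding H_def using x Suc.prems by (intro finite_set_history[of _ n]) auto
  have fx: "finite (set_pmf (x t))"
    using x Suc.prems by (auto simp: adversaries_def)
  \<comment> \<open>Potential plus \<open>\<eta>\<close> times accumulated regret is a
    supermartingale up to a drift of \<open>c\<close> per round.\<close>
  have step: "measure_pmf.expectation (x t) (\<lambda>z. measure_pmf.expectation (exp3 \<eta> l h)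
        (\<lambda>a. \<Phi> (h @ [(a, S a z)]) + \<eta> * V (Suc t) (h @ [(a, S a z)])))
      \<le> (\<Phi> h + \<eta> * V t h) + c" if h: "h \<in> set_pmf H" for h
  proof -
    define G where "G = exp3_state \<eta> l h"
    define p where "p = exp3_prob \<eta> G True"
    have p: "0 \<le> p" "p \<le> 1" unfolding p_def by (simp_all add: exp3_prob_bounds less_imp_le)
    have len: "length h = t" using h length_history unfolding H_def by blast
    have V: "V (Suc t) (h @ [(a, s)]) = V t h + (exp_loss L a (x t) - exp_loss L b (x t))" for a s
      unfolding V_def using len by (simp add: nth_append)
    have \<Phi>: "\<Phi> (h @ [(a, s)]) = exp3_potential \<eta> b (G(a := G a + l s / exp3_prob \<eta> G a))" for a s
      by (simp add: \<Phi>_def exp3_state_def G_def exp3_update_def)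
    have E: "measure_pmf.expectation (exp3 \<eta> l h) f = f True * p + f False * (1 - p)"
      for f :: "bool \<Rightarrow> real"
      using p by (simp add: exp3_def G_def[symmetric] p_def[symmetric])
    have regroup: "(P + \<eta> * (v + (c1 - c0))) * p + (Q + \<eta> * (v + (c2 - c0))) * (1 - p)
        = (P * p + Q * (1 - p)) + \<eta> * v + \<eta> * (c1 * p + c2 * (1 - p) - c0)" for P Q v c0 c1 c2
      by (simp add: algebra_simps)
    \<comment> \<open>\<open>D\<close> is \<open>\<eta>\<close> times the expected regret of this
      round. It does not depend on \<open>z\<close> and cancels once the bound for fixed
      \<open>z\<close> is averaged over \<open>x t\<close>.\<close>
    define D where "D = \<eta> * (exp_loss L True (x t) * p + exp_loss L False (x t) * (1 - p) - exp_loss L b (x t))"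
    have "measure_pmf.expectation (x t) (\<lambda>z. measure_pmf.expectation (exp3 \<eta> l h)
        (\<lambda>a. \<Phi> (h @ [(a, S a z)]) + \<eta> * V (Suc t) (h @ [(a, S a z)])))
      \<le> measure_pmf.expectation (x t) (\<lambda>z. \<Phi> h + \<eta> * V t h + c + D
            - \<eta> * (L True z * p + L False z * (1 - p) - L b z))"
    proof (rule expectation_mono_finite[OF fx])
      fix z
      have "exp3_potential \<eta> b (G(True := G True + l (S True z) / exp3_prob \<eta> G True)) * p
          + exp3_potential \<eta> b (G(False := G False + l (S False z) / exp3_prob \<eta> G False)) * (1 - p)
          \<le> \<Phi> h - \<eta> * (l (S True z) * p + l (S False z) * (1 - p) - l (S b z)) + \<eta>\<^sup>2 * B\<^sup>2"
        using exp3_potential_step[of \<eta> "\<lambda>a. l (S a z)" B b G] \<eta> l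
        by (simp add: p_def \<Phi>_def G_def)
      moreover have "(L True z - L b z) * p + (L False z - L b z) * (1 - p) - \<epsilon>
        \<le> (l (S True z) - l (S b z)) * p + (l (S False z) - l (S b z)) * (1 - p)"
      proof -
        have "((L True z - L b z) - (l (S True z) - l (S b z))) * p \<le> \<epsilon> * p"
          "((L False z - L b z) - (l (S False z) - l (S b z))) * (1 - p) \<le> \<epsilon> * (1 - p)"
          using \<epsilon>[of True z] \<epsilon>[of False z] p by (intro mult_right_mono; simp add: abs_le_iff)+
        then show ?thesis by (simp add: algebra_simps)
      qed
      then have "\<eta> * (L True z * p + L False z * (1 - p) - L b z - \<epsilon>)
        \<le> \<eta> * (l (S True z) * p + l (S False z) * (1 - p) - l (S b z))"
        using \<eta> by (intro mult_left_mono) (auto simp: algebra_simps)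
      ultimately show "measure_pmf.expectation (exp3 \<eta> l h)
          (\<lambda>a. \<Phi> (h @ [(a, S a z)]) + \<eta> * V (Suc t) (h @ [(a, S a z)]))
          \<le> \<Phi> h + \<eta> * V t h + c + D - \<eta> * (L True z * p + L False z * (1 - p) - L b z)"
        using p by (simp only: E \<Phi> V regroup c_def) (simp add: D_def algebra_simps power2_eq_square)
    qed
    also have "\<dots> = \<Phi> h + \<eta> * V t h + c + D
        - \<eta> * (exp_loss L True (x t) * p + exp_loss L False (x t) * (1 - p) - exp_loss L b (x t))"
      unfolding exp_loss_def
      by (simp add: integrable_measure_pmf_finite[OF fx])
    finally show ?thesis by (simp add: D_def)
  qed
  have "measure_pmf.expectation (history S (exp3 \<eta> l) x (Suc t)) (\<lambda>h. \<Phi> h + \<eta> * V (Suc t) h)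
      \<le> measure_pmf.expectation H (\<lambda>h. (\<Phi> h + \<eta> * V t h) + c)"
    using x Suc.prems unfolding H_def
    by (subst expectation_history_Suc[of _ n])
       (auto intro!: expectation_mono_finite step fH simp flip: H_def)
  also have "\<dots> = measure_pmf.expectation H (\<lambda>h. \<Phi> h + \<eta> * V t h) + c"
    by (subst Bochner_Integration.integral_add) (auto intro: integrable_measure_pmf_finite fH)
  also have "\<dots> \<le> ln 2 + real t * c + c"
    using Suc by (simp add: H_def \<Phi>_def V_def c_def)
  finally show ?case
    by (simp add: \<Phi>_def V_def c_def algebra_simps)
qed

lemma regret_exp3_le:
  assumes \<eta>: "0 < \<eta>" and l: "\<And>s. 0 \<le> l s" "\<And>s. l s \<le> B"
    and \<epsilon>: "\<And>a b z. \<bar>(L a z - L b z) - (l (S a z) - l (S b z))\<bar> \<le> \<epsilon>"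
    and x: "x \<in> adversaries n" and n: "n > 0"
  shows "regret L S n (exp3 \<eta> l) x \<le> ln 2 / \<eta> + real n * (\<epsilon> + \<eta> * B\<^sup>2)"
proof -
  obtain b where b: "regret L S n (exp3 \<eta> l) x = measure_pmf.expectation (history S (exp3 \<eta> l) x n)
      (\<lambda>h. \<Sum>t<n. exp_loss L (fst (h ! t)) (x t) - exp_loss L b (x t))"
    using regret_eq[OF x n] .
  have "\<eta> * regret L S n (exp3 \<eta> l) x = measure_pmf.expectation (history S (exp3 \<eta> l) x n)
      (\<lambda>h. \<eta> * (\<Sum>t<n. exp_loss L (fst (h ! t)) (x t) - exp_loss L b (x t)))"
    unfolding b by simp
  also have "\<dots> \<le> measure_pmf.expectation (history S (exp3 \<eta> l) x n)
      (\<lambda>h. exp3_potential \<eta> b (exp3_state \<eta> l h)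
        + \<eta> * (\<Sum>s<n. exp_loss L (fst (h ! s)) (x s) - exp_loss L b (x s)))"
    by (intro expectation_mono_finite finite_set_history[OF x])
      (auto simp: exp3_potential_nonneg)
  also have "\<dots> \<le> ln 2 + real n * (\<eta> * (\<epsilon> + \<eta> * B\<^sup>2))"
    by (intro exp3_potential_history[where n = n] \<eta> l \<epsilon> x) simp
  finally show ?thesis
    using \<eta> by (simp add: field_simps)
qed

subsection \<open>Overlap of two interactions\<close>

lemma pmf_bind_map_inj:
  assumes inj: "\<And>u v u' v'. f u v = f u' v' \<longleftrightarrow> u = u' \<and> v = v'"
  shows "pmf (bind_pmf p (\<lambda>u. map_pmf (f u) (K u))) (f u v) = pmf p u * pmf (K u) v"
proof -
  have "pmf (map_pmf (f u') (K u')) (f u v) = indicator {u} u' * pmf (K u) v" for u'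
  proof (cases "u' = u")
    case True
    then show ?thesis by (simp add: pmf_map_inj' inj_def inj)
  next
    case False
    then have "f u v \<notin> set_pmf (map_pmf (f u') (K u'))"
      by (auto simp: inj)
    with False show ?thesis by (simp add: pmf_eq_0_set_pmf)
  qed
  then show ?thesis
    by (simp add: pmf_bind measure_pmf_single)
qed

text \<open>Chain rule for histories: the learner's factor \<open>pmf (\<pi> h) a\<close> is the
  same in every environment \<open>x\<close>.\<close>

lemma pmf_history_snoc:
  "pmf (history S \<pi> x (Suc t)) (h @ [(a, s)])
     = pmf (history S \<pi> x t) h * (pmf (\<pi> h) a * pmf (map_pmf (S a) (x t)) s)"
proof -
  define K where "K h = bind_pmf (\<pi> h) (\<lambda>a. map_pmf (Pair a) (map_pmf (S a) (x t)))" for h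
  have "history S \<pi> x (Suc t) = bind_pmf (history S \<pi> x t) (\<lambda>h. map_pmf (\<lambda>y. h @ [y]) (K h))"
    by (simp add: K_def map_bind_pmf bind_assoc_pmf bind_return_pmf map_pmf_def)
  moreover have "pmf (K h) (a, s) = pmf (\<pi> h) a * pmf (map_pmf (S a) (x t)) s"
    unfolding K_def by (subst pmf_bind_map_inj) auto
  ultimately show ?thesis
    by (simp only:) (subst pmf_bind_map_inj, auto)
qed

text \<open>A finite set that contains the supports of the histories in both environments, so that
  overlaps are finite sums.\<close>

definition transcripts :: "nat \<Rightarrow> nat \<Rightarrow> (bool \<times> nat) list set" where
  "transcripts m t = {h. set h \<subseteq> UNIV \<times> {..m} \<and> length h = t}"

lemma finite_transcripts: "finite (transcripts m t)"
  unfolding transcripts_def by (rule finite_lists_length_eq) auto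

lemma transcripts_0: "transcripts m 0 = {[]}"
  by (auto simp: transcripts_def)

lemma bij_betw_transcripts_Suc:
  "bij_betw (\<lambda>(h, a, s). h @ [(a, s)]) (transcripts m t \<times> UNIV \<times> {..m}) (transcripts m (Suc t))"
  unfolding bij_betw_def
proof
  show "inj_on (\<lambda>(h, a, s). h @ [(a, s)]) (transcripts m t \<times> UNIV \<times> {..m})"
    by (auto simp: inj_on_def)
  show "(\<lambda>(h, a, s). h @ [(a, s)]) ` (transcripts m t \<times> UNIV \<times> {..m}) = transcripts m (Suc t)"
  proof (intro equalityI subsetI)
    fix h assume "h \<in> transcripts m (Suc t)"
    then have h: "set h \<subseteq> UNIV \<times> {..m}" "length h = Suc t"
      by (auto simp: transcripts_def)
    then obtain h' a s where "h = h' @ [(a, s)]"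
      by (metis length_Suc_conv_rev surj_pair)
    with h show "h \<in> (\<lambda>(h, a, s). h @ [(a, s)]) ` (transcripts m t \<times> UNIV \<times> {..m})"
      by (auto simp: transcripts_def image_iff)
  qed (auto simp: transcripts_def)
qed

lemma set_history_transcripts:
  assumes "\<And>t a. set_pmf (map_pmf (S a) (x t)) \<subseteq> {..m}"
  shows "set_pmf (history S \<pi> x t) \<subseteq> transcripts m t"
proof (induction t)
  case (Suc t)
  have "S a z \<le> m" if "z \<in> set_pmf (x t)" for a z
    using assms[of a t] that by auto
  moreover have "s \<le> m" if "h \<in> set_pmf (history S \<pi> x t)" "(a, s) \<in> set h" for h a s
    using subsetD[OF Suc that(1)] that(2) by (auto simp: transcripts_def)
  ultimately show ?case
    by (auto simp: set_bind_pmf transcripts_def dest: length_history)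
qed (simp add: transcripts_0)

text \<open>By the chain rule the learner's factor occurs squared under the root and comes out as
  \<open>pmf (\<pi> h) a\<close>. Each action contributes at least \<open>\<rho>\<close> per round,
  hence so does every mixture of actions.\<close>

lemma history_overlap_ge:
  assumes \<rho>: "0 \<le> \<rho>"
    and step: "\<And>a. \<rho> \<le> (\<Sum>s\<le>m. sqrt (pmf (map_pmf (S a) x) s * pmf (map_pmf (S a) y) s))"
  shows "\<rho> ^ t \<le> (\<Sum>h\<in>transcripts m t.
    sqrt (pmf (history S \<pi> (\<lambda>_. x) t) h * pmf (history S \<pi> (\<lambda>_. y) t) h))"
proof (induction t)
  case 0
  then show ?case by (simp add: transcripts_0)
next
  case (Suc t)
  define r where "r h = sqrt (pmf (history S \<pi> (\<lambda>_. x) t) h * pmf (history S \<pi> (\<lambda>_. y) t) h)" for h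
  define c where "c a s = sqrt (pmf (map_pmf (S a) x) s * pmf (map_pmf (S a) y) s)" for a s
  have factor: "sqrt (pmf (history S \<pi> (\<lambda>_. x) (Suc t)) (h @ [(a, s)])
        * pmf (history S \<pi> (\<lambda>_. y) (Suc t)) (h @ [(a, s)])) = r h * (pmf (\<pi> h) a * c a s)" for h a s
  proof -
    have "sqrt ((p1 * (v * q1)) * (p2 * (v * q2))) = sqrt (p1 * p2) * (v * sqrt (q1 * q2))"
      if "0 \<le> v" for p1 p2 q1 q2 v :: real
    proof -
      have "(p1 * (v * q1)) * (p2 * (v * q2)) = (p1 * p2) * (v\<^sup>2 * (q1 * q2))"
        by (simp add: power2_eq_square)
      then show ?thesis using that by (simp only: real_sqrt_mult real_sqrt_abs abs_of_nonneg)
    qed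
    then show ?thesis
      by (simp only: pmf_history_snoc r_def c_def pmf_nonneg)
  qed
  have r: "0 \<le> r h" for h by (simp add: r_def)
  have "\<rho> ^ Suc t \<le> (\<Sum>h\<in>transcripts m t. r h) * \<rho>"
    using Suc \<rho> by (simp add: r_def mult.commute mult_left_mono)
  also have "\<dots> \<le> (\<Sum>h\<in>transcripts m t. r h * (\<Sum>a\<in>UNIV. pmf (\<pi> h) a * (\<Sum>s\<le>m. c a s)))"
    unfolding sum_distrib_right
  proof (intro sum_mono mult_left_mono r)
    fix h
    have "\<rho> = (\<Sum>a\<in>UNIV. pmf (\<pi> h) a * \<rho>)"
      by (simp add: sum_distrib_right[symmetric] sum_pmf_eq_1)
    also have "\<dots> \<le> (\<Sum>a\<in>UNIV. pmf (\<pi> h) a * (\<Sum>s\<le>m. c a s))"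
      using step by (intro sum_mono mult_left_mono) (auto simp: c_def)
    finally show "\<rho> \<le> (\<Sum>a\<in>UNIV. pmf (\<pi> h) a * (\<Sum>s\<le>m. c a s))" .
  qed
  also have "\<dots> = (\<Sum>(h, a, s)\<in>transcripts m t \<times> UNIV \<times> {..m}. r h * (pmf (\<pi> h) a * c a s))"
    by (simp add: sum.cartesian_product[symmetric] sum_distrib_left)
  also have "\<dots> = (\<Sum>h\<in>transcripts m (Suc t).
    sqrt (pmf (history S \<pi> (\<lambda>_. x) (Suc t)) h * pmf (history S \<pi> (\<lambda>_. y) (Suc t)) h))"
    by (subst sum.reindex_bij_betw[OF bij_betw_transcripts_Suc, symmetric])
      (auto simp: factor split_def intro!: sum.cong simp del: history.simps)
  finally show ?case .
qed

text \<open>Expanding \<open>(sqrt u - l * sqrt v)\<^sup>2 \<ge> 0\<close> bounds \<open>u\<close>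
  below by \<open>2 * l * sqrt (u * v) - l\<^sup>2 * v\<close>; subtracting
  \<open>l\<^sup>2 * u\<close> as well makes the bound symmetric.\<close>

lemma min_ge_sqrt:
  fixes a b l :: real
  assumes "0 \<le> a" "0 \<le> b" "0 \<le> l"
  shows "l * (2 * sqrt (a * b) - l * (a + b)) \<le> min a b"
proof -
  have *: "l * (2 * sqrt (u * v) - l * (u + v)) \<le> u" if "0 \<le> u" "0 \<le> v" for u v :: real
  proof -
    have "0 \<le> (sqrt u - l * sqrt v)\<^sup>2" by simp
    also have "\<dots> = u - 2 * l * sqrt (u * v) + l\<^sup>2 * v"
      using that by (simp add: power2_diff power_mult_distrib real_sqrt_mult)
    finally have "l * (2 * sqrt (u * v) - l * v) \<le> u"
      by (simp add: algebra_simps power2_eq_square)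
    moreover have "0 \<le> l * (l * u)" using that assms by simp
    ultimately show ?thesis by (simp add: algebra_simps)
  qed
  from *[of a b] *[of b a] assms show ?thesis
    by (simp add: mult.commute add.commute)
qed

text \<open>A linear form of Le Cam's two-point bound: the previous inequality with \<open>l = 1 / 4\<close> avoids
  Cauchy--Schwarz.\<close>

lemma overlap_testing:
  fixes f g :: "'a \<Rightarrow> real"
  assumes fin: "finite H" and sub: "set_pmf p \<subseteq> H" "set_pmf r \<subseteq> H"
    and pos: "\<And>h. 0 \<le> f h" "\<And>h. 0 \<le> g h"
    and c: "0 \<le> c" "\<And>h. h \<in> H \<Longrightarrow> f h + g h = c"
    and overlap: "1 / 2 \<le> (\<Sum>h\<in>H. sqrt (pmf p h * pmf r h))"
  shows "c / 8 \<le> measure_pmf.expectation p f + measure_pmf.expectation r g"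
proof -
  have one: "(\<Sum>h\<in>H. pmf p h) = 1" "(\<Sum>h\<in>H. pmf r h) = 1"
    using fin sub by (auto intro: sum_pmf_eq_1)
  \<comment> \<open>With both masses 1 and overlap at least 1/2, the right side is at least
    \<open>1 / 4 * (1 - 1 / 4 * 2)\<close>.\<close>
  have "1 / 8 \<le> 1 / 4 * (2 * (\<Sum>h\<in>H. sqrt (pmf p h * pmf r h)) - 1 / 4 * ((\<Sum>h\<in>H. pmf p h) + (\<Sum>h\<in>H. pmf r h)))"
    using overlap unfolding one by simp
  also have "\<dots> = (\<Sum>h\<in>H. 1 / 4 * (2 * sqrt (pmf p h * pmf r h) - 1 / 4 * (pmf p h + pmf r h)))"
    by (simp add: sum_subtractf sum.distrib flip: sum_distrib_left sum_divide_distrib)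
  also have "\<dots> \<le> (\<Sum>h\<in>H. min (pmf p h) (pmf r h))"
    by (intro sum_mono min_ge_sqrt) auto
  finally have "c / 8 \<le> c * (\<Sum>h\<in>H. min (pmf p h) (pmf r h))"
    using c(1) mult_left_mono[of "1/8" _ c] by simp
  also have "\<dots> \<le> (\<Sum>h\<in>H. f h * pmf p h + g h * pmf r h)"
    unfolding sum_distrib_left
  proof (rule sum_mono)
    fix h assume h: "h \<in> H"
    have "c * min (pmf p h) (pmf r h) = f h * min (pmf p h) (pmf r h) + g h * min (pmf p h) (pmf r h)"
      by (simp add: c(2)[OF h, symmetric] algebra_simps)
    also have "\<dots> \<le> f h * pmf p h + g h * pmf r h"
      using pos by (intro add_mono mult_left_mono) auto
    finally show "c * min (pmf p h) (pmf r h) \<le> f h * pmf p h + g h * pmf r h" .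
  qed
  also have "\<dots> = measure_pmf.expectation p f + measure_pmf.expectation r g"
    using fin sub by (subst (1 2) integral_measure_pmf_real[of H]) (auto simp: sum.distrib)
  finally show ?thesis .
qed

subsection \<open>The game\<close>

definition gap :: "real \<Rightarrow> nat \<Rightarrow> real" where
  "gap g i = real (Suc i) powr g - real i powr g"

text \<open>The outcome \<open>z\<close> encodes the edge at level \<open>z div 2\<close> whose upper action is \<open>even z\<close>.\<close>

definition game_loss :: "real \<Rightarrow> bool \<Rightarrow> nat \<Rightarrow> real" where
  "game_loss g a z = of_bool (a = even z) * gap g (z div 2)"

definition game_signal :: "bool \<Rightarrow> nat \<Rightarrow> nat" where
  "game_signal a z = z div 2 + of_bool (a = even z)"

lemma gap_nonneg: "0 \<le> g \<Longrightarrow> 0 \<le> gap g i"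
  by (simp add: gap_def powr_mono2)

text \<open>Write \<open>j powr g\<close> as \<open>j * j powr (g - 1)\<close> and replace the
  second factor at \<open>i + 1\<close> by the larger one at \<open>i\<close>.\<close>

lemma gap_le:
  assumes "g \<le> 1" "1 \<le> k" "k \<le> i"
  shows "gap g i \<le> real k powr (g - 1)"
proof -
  have split: "real j powr g = real j * real j powr (g - 1)" if "1 \<le> j" for j
    using that powr_add[of "real j" 1 "g - 1"] by simp
  have "gap g i = real (Suc i) * real (Suc i) powr (g - 1) - real i * real i powr (g - 1)"
    using assms split[of i] split[of "Suc i"] by (simp add: gap_def)
  also have "\<dots> \<le> real (Suc i) * real i powr (g - 1) - real i * real i powr (g - 1)"
    using assms by (intro diff_right_mono mult_left_mono powr_mono2') auto
  also have "\<dots> = real i powr (g - 1)"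
    by (simp add: algebra_simps)
  also have "\<dots> \<le> real k powr (g - 1)"
    using assms by (intro powr_mono2') auto
  finally show ?thesis .
qed

lemma gap_le_1: "g \<le> 1 \<Longrightarrow> gap g i \<le> 1"
  using gap_le[of g 1 i] by (cases "i = 0") (auto simp: gap_def)

text \<open>For \<open>j = i + 1\<close>, weighted AM-GM gives
  \<open>i powr g * j powr (1 - g) \<le> g * i + (1 - g) * j = j - g\<close>. Multiplying by
  \<open>j powr (g - 1)\<close> yields \<open>gap g i \<ge> g * j powr (g - 1)\<close>, and
  \<open>j \<le> m\<close>.\<close>

lemma gap_ge:
  assumes "0 < g" "g < 1" "i < m"
  shows "g * real m powr (g - 1) \<le> gap g i"
proof -
  define j where "j = real (Suc i)"
  have j: "1 \<le> j" by (simp add: j_def)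
  have "g * real m powr (g - 1) \<le> g * j powr (g - 1)"
    using assms by (intro mult_left_mono powr_mono2') (auto simp: j_def)
  moreover have "real i powr g * j powr (1 - g) \<le> g * real i + (1 - g) * j"
  proof (cases "i = 0")
    case False
    then show ?thesis using assms j by (intro Youngs_inequality_0) auto
  qed (use assms j in auto)
  then have "(real i powr g * j powr (1 - g)) * j powr (g - 1) \<le> (j - g) * j powr (g - 1)"
    by (intro mult_right_mono) (auto simp: j_def algebra_simps)
  moreover have "(real i powr g * j powr (1 - g)) * j powr (g - 1) = real i powr g"
    unfolding mult.assoc powr_add[symmetric] using j by simp
  moreover have "j * j powr (g - 1) = j powr g"
    using j powr_add[of j 1 "g - 1"] by simp
  ultimately show ?thesis
    unfolding gap_def j_def[symmetric] by (simp add: left_diff_distrib)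
qed

lemma game_loss_bounds:
  assumes "0 \<le> g" "g \<le> 1"
  shows "0 \<le> game_loss g a z \<and> game_loss g a z \<le> 1"
  using gap_nonneg[of g] gap_le_1[of g] assms by (simp add: game_loss_def)

text \<open>Below level \<open>k\<close> the increments of \<open>l\<close> are exactly the gaps.
  From \<open>k\<close> on, \<open>l\<close> is constant and the gap itself is within the allowed
  error.\<close>

lemma game_loss_diff_approx:
  assumes g: "0 \<le> g" "g \<le> 1" and k: "1 \<le> k"
  defines "l \<equiv> \<lambda>s. real (min s k) powr g"
  shows "\<bar>(game_loss g a z - game_loss g b z) - (l (game_signal a z) - l (game_signal b z))\<bar>
    \<le> real k powr (g - 1)"
proof -
  have "\<bar>gap g i - (l (Suc i) - l i)\<bar> \<le> real k powr (g - 1)" for i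
    using gap_le[of g k i] gap_nonneg[of g i] g k
    by (cases "i < k") (auto simp: l_def gap_def min_def)
  from this[of "z div 2"] show ?thesis
    by (cases a; cases b; cases "even z") (auto simp: game_loss_def game_signal_def abs_le_iff)
qed

lemma ceiling_sqrt_bounds:
  assumes "1 \<le> (r::real)"
  defines "k \<equiv> nat \<lceil>sqrt r\<rceil>"
  shows "1 \<le> k" "sqrt r \<le> real k" "real k \<le> 2 * sqrt r"
proof -
  have "1 \<le> sqrt r" using assms by simp
  then show "1 \<le> k" "sqrt r \<le> real k" "real k \<le> 2 * sqrt r"
    unfolding k_def by linarith+
qed

section \<open>Upper bound on the minimax regret\<close>

lemma minimax_regret_game_le:
  assumes g: "0 < g" "g < 1" and n: "n > 0"
  shows "minimax_regret (game_loss g) game_signal n \<le> 5 * real n powr ((1 + g) / 2)"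
proof -
  define k where "k = nat \<lceil>sqrt (real n)\<rceil>"
  have k: "1 \<le> k" "sqrt (real n) \<le> real k" "real k \<le> 2 * sqrt (real n)"
    unfolding k_def using n by (intro ceiling_sqrt_bounds; simp)+
  define l where "l = (\<lambda>s. real (min s k) powr g)"
  define B where "B = real k powr g"
  have B: "0 < B" using k by (simp add: B_def)
  \<comment> \<open>This rate balances \<open>ln 2 / \<eta>\<close> against
    \<open>n * \<eta> * B\<^sup>2\<close>: both are of order \<open>B * sqrt n\<close>.\<close>
  define \<eta> where "\<eta> = 1 / (B * sqrt (real n))"
  have \<eta>: "0 < \<eta>" using B n by (simp add: \<eta>_def)
  have sqrt: "sqrt (real n) = real n powr (1 / 2)" by (simp add: powr_half_sqrt)
  have "minimax_regret (game_loss g) game_signal n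
      \<le> ln 2 / \<eta> + real n * (real k powr (g - 1) + \<eta> * B\<^sup>2)"
  proof (rule minimax_regret_le[of _ _ _ "exp3 \<eta> l"])
    show "regret (game_loss g) game_signal n (exp3 \<eta> l) x
        \<le> ln 2 / \<eta> + real n * (real k powr (g - 1) + \<eta> * B\<^sup>2)" if "x \<in> adversaries n" for x
      using \<eta> that n g k unfolding l_def
      by (intro regret_exp3_le game_loss_diff_approx) (auto simp: B_def intro!: powr_mono2)
  qed (use g n game_loss_bounds in auto)
  also have "\<dots> = ln 2 * B * sqrt (real n) + B * sqrt (real n) + real n * real k powr (g - 1)"
  proof -
    have "real n * (\<eta> * B\<^sup>2) = B * (real n / sqrt (real n))"
      using B by (simp add: \<eta>_def power2_eq_square)
    also have "\<dots> = B * sqrt (real n)"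
      by (simp add: real_div_sqrt)
    finally show ?thesis by (simp add: distrib_left \<eta>_def)
  qed
  also have "\<dots> \<le> 2 * (B * sqrt (real n)) + real n * real k powr (g - 1)"
    using ln_2_less_1 B mult_right_mono[of "ln 2" 1 "B * sqrt (real n)"] by simp
  also have "B * sqrt (real n) \<le> (2 * sqrt (real n)) powr g * sqrt (real n)"
    unfolding B_def using k g by (intro mult_right_mono powr_mono2) auto
  also have "\<dots> = 2 powr g * real n powr ((1 + g) / 2)"
    using n unfolding sqrt by (simp add: powr_mult powr_powr powr_add[symmetric] add_divide_distrib add.commute)
  \<comment> \<open>The constant 5 is \<open>2 * 2 + 1\<close>: twice this bound, plus the
    truncation term.\<close>
  also have "\<dots> \<le> 2 * real n powr ((1 + g) / 2)"
    using g powr_mono[of g 1 2] by (intro mult_right_mono) auto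
  also have "real n * real k powr (g - 1) \<le> real n * sqrt (real n) powr (g - 1)"
    using k g n by (intro mult_left_mono powr_mono2') auto
  also have "\<dots> = real n powr 1 * (real n powr (1/2)) powr (g - 1)"
    using n by (simp add: sqrt)
  also have "\<dots> = real n powr (1 + 1 / 2 * (g - 1))"
    by (simp only: powr_powr powr_add)
  also have "1 + 1 / 2 * (g - 1) = (1 + g) / 2" by (simp add: field_simps)
  finally show ?thesis by simp
qed

subsection \<open>Tilted environments\<close>

text \<open>Counting the value 0 just beyond either end, neighbouring values differ by at most
  \<open>1 / m\<close>, while the mean stays of constant order.\<close>

definition tent :: "nat \<Rightarrow> nat \<Rightarrow> real" where
  "tent m i = real (min (Suc i) (m - i)) / real m"

text \<open>In \<open>tilted_env m b\<close> the action \<open>b\<close> is the upper one with probability at least one half.\<close>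

definition tilted_env :: "nat \<Rightarrow> bool \<Rightarrow> nat pmf" where
  "tilted_env m b = bind_pmf (pmf_of_set {..<m}) (\<lambda>i.
     map_pmf (\<lambda>e. 2 * i + of_bool (e \<noteq> b)) (bernoulli_pmf ((1 + tent m i) / 2)))"

lemma tent_bounds: "0 \<le> tent m i" "tent m i \<le> 1"
  by (auto simp: tent_def divide_simps)

lemma set_tilted_env:
  assumes "m > 0"
  shows "set_pmf (tilted_env m b) \<subseteq> {..<2 * m}"
  using assms by (auto simp: tilted_env_def set_bind_pmf lessThan_empty_iff split: if_splits)

lemma set_signal_tilted_env:
  assumes "m > 0"
  shows "set_pmf (map_pmf (game_signal a) (tilted_env m b)) \<subseteq> {..m}"
proof -
  have "z div 2 + of_bool (a = even z) \<le> m" if "z < 2 * m" for z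
    using that by (cases "a = even z") auto
  then show ?thesis
    using set_tilted_env[OF assms, of b] by (auto simp: game_signal_def)
qed

lemma sum_tent_ge: "real m / 4 \<le> (\<Sum>i<m. tent m i)"
proof -
  have "m * m \<le> 4 * (\<Sum>i<m. min (Suc i) (m - i))"
  \<comment> \<open>Cutting both ends off the tent of length \<open>n + 2\<close> leaves the one of
    length \<open>n\<close> raised by 1, so the sum grows by \<open>n + 2\<close>, and
    \<open>4 * (n + 2) \<ge> (n + 2)\<^sup>2 - n\<^sup>2\<close>.\<close>
  proof (induction m rule: induct_nat_012)
    case (ge2 n)
    have "(\<Sum>i<Suc (Suc n). min (Suc i) (Suc (Suc n) - i))
       = (\<Sum>i<Suc n. min (Suc (Suc i)) (Suc n - i)) + 1"
      by (subst sum.lessThan_Suc_shift) simp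
    also have "\<dots> = (\<Sum>i<n. min (Suc (Suc i)) (Suc n - i)) + 2"
      by simp
    also have "(\<Sum>i<n. min (Suc (Suc i)) (Suc n - i)) = (\<Sum>i<n. Suc (min (Suc i) (n - i)))"
      by (intro sum.cong) (auto simp: Suc_diff_le)
    also have "\<dots> = (\<Sum>i<n. min (Suc i) (n - i)) + n"
      by (simp add: sum_Suc)
    finally show ?case using ge2 by simp
  qed auto
  then have "real (m * m) \<le> real (4 * (\<Sum>i<m. min (Suc i) (m - i)))"
    by (rule of_nat_mono)
  then have "real m * real m \<le> 4 * real (\<Sum>i<m. min (Suc i) (m - i))"
    by (simp only: of_nat_mult of_nat_numeral)
  moreover have "(\<Sum>i<m. tent m i) = real (\<Sum>i<m. min (Suc i) (m - i)) / real m"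
    unfolding tent_def sum_divide_distrib[symmetric] of_nat_sum[symmetric] ..
  ultimately show ?thesis
    by (cases "m = 0") (simp_all add: pos_le_divide_eq del: of_nat_sum)
qed

lemma expectation_tilted_env:
  fixes f :: "nat \<Rightarrow> real"
  assumes "m > 0"
  shows "measure_pmf.expectation (tilted_env m b) f =
    (\<Sum>i<m. f (2 * i + of_bool (\<not> b)) * ((1 + tent m i) / 2) + f (2 * i + of_bool b) * ((1 - tent m i) / 2)) / real m"
proof -
  define K where "K i = map_pmf (\<lambda>e. 2 * i + of_bool (e \<noteq> b)) (bernoulli_pmf ((1 + tent m i) / 2))"
    for i :: nat
  have K: "measure_pmf.expectation (K i) f
      = f (2 * i + of_bool (\<not> b)) * ((1 + tent m i) / 2) + f (2 * i + of_bool b) * ((1 - tent m i) / 2)"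
    for i
  proof -
    have "1 - (1 + tent m i) / 2 = (1 - tent m i) / 2" by (simp add: field_simps)
    moreover have "0 \<le> (1 + tent m i) / 2" "(1 + tent m i) / 2 \<le> 1"
      using tent_bounds[of m i] by auto
    ultimately show ?thesis
      by (simp add: K_def del: of_bool_not_iff)
  qed
  have "measure_pmf.expectation (tilted_env m b) f
      = (\<Sum>i<m. measure_pmf.expectation (K i) f /\<^sub>R real (card {..<m}))"
    unfolding tilted_env_def K_def using assms
    by (intro pmf_expectation_bind_pmf_of_set) (auto simp: lessThan_empty_iff)
  also have "\<dots> = (\<Sum>i<m. measure_pmf.expectation (K i) f) / real m"
    by (simp add: divide_inverse mult.commute flip: sum_distrib_left)
  finally show ?thesis unfolding K .
qed

lemma exp_loss_tilted_env:
  assumes "m > 0"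
  shows "exp_loss (game_loss g) b (tilted_env m b) - exp_loss (game_loss g) (\<not> b) (tilted_env m b)
    = (\<Sum>i<m. tent m i * gap g i) / real m"
  unfolding exp_loss_def expectation_tilted_env[OF assms] diff_divide_distrib[symmetric] sum_subtractf[symmetric]
  by (intro arg_cong2[where f = "(/)"] sum.cong) (cases b; simp add: game_loss_def field_simps)+

text \<open>Here \<open>b\<close> is the worse action. The tent has mean at least 1/4, and every gap
  on the first \<open>m\<close> edges is at least \<open>g * m powr (g - 1)\<close>.\<close>

lemma exp_loss_tilted_env_ge:
  assumes g: "0 < g" "g < 1" and m: "m > 0"
  shows "g * real m powr (g - 1) / 4
    \<le> exp_loss (game_loss g) b (tilted_env m b) - exp_loss (game_loss g) (\<not> b) (tilted_env m b)"
proof -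
  have "real m * (g * real m powr (g - 1) / 4) = real m / 4 * (g * real m powr (g - 1))"
    by simp
  also have "\<dots> \<le> (\<Sum>i<m. tent m i) * (g * real m powr (g - 1))"
    using g sum_tent_ge[of m] by (intro mult_right_mono) auto
  also have "\<dots> \<le> (\<Sum>i<m. tent m i * gap g i)"
    unfolding sum_distrib_right using gap_ge g by (intro sum_mono mult_left_mono tent_bounds) auto
  finally show ?thesis
    unfolding exp_loss_tilted_env[OF m] using m by (simp add: field_simps)
qed

text \<open>Level \<open>j\<close> is seen as the upper end of edge \<open>j - 1\<close> or as the
  lower end of edge \<open>j\<close>, and the two tilts enter with opposite signs. The indicators
  remove the missing edges at \<open>j = 0\<close> and \<open>j = m\<close>.\<close>

lemma pmf_signal_tilted_env:
  assumes "m > 0"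
  defines "\<sigma> \<equiv> \<lambda>a b. if a = b then 1 else - 1"
  shows "pmf (map_pmf (game_signal a) (tilted_env m b)) j =
    (of_bool (0 < j \<and> j \<le> m) * (1 + \<sigma> a b * tent m (j - 1))
      + of_bool (j < m) * (1 - \<sigma> a b * tent m j)) / (2 * real m)"
proof -
  have delta: "(\<Sum>i<m. of_bool (i = j) * F i) = of_bool (j < m) * F j" for F :: "nat \<Rightarrow> real"
    by (simp add: of_bool_def if_distrib[of "\<lambda>c. c * _"] sum.delta cong: if_cong)
  have delta': "(\<Sum>i<m. of_bool (Suc i = j) * F i) = of_bool (0 < j \<and> j \<le> m) * F (j - 1)"
    for F :: "nat \<Rightarrow> real"
    by (cases j) (auto simp: of_bool_def if_distrib[of "\<lambda>c. c * _"] sum.delta cong: if_cong)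
  have sig: "game_signal a (2 * i + of_bool (\<not> b)) = i + of_bool (a = b)"
    "game_signal a (2 * i + of_bool b) = i + of_bool (a \<noteq> b)" for i
    by (cases a; cases b; simp add: game_signal_def)+
  have "pmf (map_pmf (game_signal a) (tilted_env m b)) j
     = measure_pmf.expectation (map_pmf (game_signal a) (tilted_env m b)) (indicator {j})"
    by (simp add: measure_pmf_single del: integral_map_pmf)
  also have "\<dots> = measure_pmf.expectation (tilted_env m b) (\<lambda>z. of_bool (game_signal a z = j))"
    unfolding integral_map_pmf by (intro Bochner_Integration.integral_cong) (auto simp: indicator_def)
  also have "\<dots> = ((\<Sum>i<m. of_bool (i + of_bool (a = b) = j) * ((1 + tent m i) / 2))
      + (\<Sum>i<m. of_bool (i + of_bool (a \<noteq> b) = j) * ((1 - tent m i) / 2))) / real m"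
    unfolding expectation_tilted_env[OF assms(1)] sig sum.distrib ..
  also have "\<dots> = (of_bool (0 < j \<and> j \<le> m) * (1 + \<sigma> a b * tent m (j - 1))
      + of_bool (j < m) * (1 - \<sigma> a b * tent m j)) / (2 * real m)"
    using assms by (cases "a = b")
      (simp_all only: \<sigma>_def delta delta' simp_thms if_True if_False of_bool_eq add_0_right
        Suc_eq_plus1[symmetric], simp_all add: field_simps)
  finally show ?thesis .
qed

text \<open>After squaring, the two sides differ by
  \<open>D\<^sup>2 * (2 * A - D\<^sup>2 - 1)\<close>.\<close>

lemma diff_square_le_sqrt:
  fixes A D :: real
  assumes "1 \<le> A" "\<bar>D\<bar> \<le> 1"
  shows "A - D\<^sup>2 \<le> sqrt ((A + D) * (A - D))"
proof (rule real_le_rsqrt)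
  have "D\<^sup>2 \<le> 1" using assms(2) by (simp add: abs_square_le_1)
  then have "0 \<le> D\<^sup>2 * (2 * A - D\<^sup>2 - 1)"
    using assms(1) by (intro mult_nonneg_nonneg) auto
  then show "(A - D\<^sup>2)\<^sup>2 \<le> (A + D) * (A - D)"
    by (simp add: algebra_simps power2_eq_square)
qed

text \<open>Exchanging the environments flips the sign of \<open>D\<close> in
  \<open>(A + D) / (2 * m)\<close>, so the overlap at a level falls short of the mean of the two
  probabilities only to second order in \<open>D\<close>.\<close>

lemma signal_overlap_ge:
  assumes m: "m > 0"
  shows "1 - 1 / (real m)\<^sup>2 \<le> (\<Sum>j\<le>m. sqrt (pmf (map_pmf (game_signal a) (tilted_env m True)) j
    * pmf (map_pmf (game_signal a) (tilted_env m False)) j))"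
proof -
  define P where "P b = pmf (map_pmf (game_signal a) (tilted_env m b))" for b
  have le: "(P True j + P False j) / 2 - 1 / (2 * real m ^ 3) \<le> sqrt (P True j * P False j)"
    if "j \<le> m" for j
  proof -
    define A :: real where "A = of_bool (0 < j \<and> j \<le> m) + of_bool (j < m)"
    define D where "D = of_bool (0 < j \<and> j \<le> m) * tent m (j - 1) - of_bool (j < m) * tent m j"
    define \<sigma> :: "bool \<Rightarrow> real" where "\<sigma> b = (if a = b then 1 else - 1)" for b
    have P: "P b j = (A + \<sigma> b * D) / (2 * real m)" for b
      unfolding P_def pmf_signal_tilted_env[OF m] A_def D_def \<sigma>_def by (simp add: algebra_simps)
    have A: "1 \<le> A" using that m by (auto simp: A_def)
    have D: "\<bar>D\<bar> \<le> 1 / real m"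
    proof -
      \<comment> \<open>Scaled by \<open>m\<close>, the two tent values become integers differing by
        at most 1; a missing edge at \<open>j = 0\<close> or \<open>j = m\<close> counts as height 0
        next to height 1.\<close>
      have "D * real m = real (of_bool (0 < j) * min j (Suc m - j)) - real (min (Suc j) (m - j))"
        using m that by (cases j) (auto simp: D_def tent_def field_simps)
      moreover have "\<bar>real (of_bool (0 < j) * min j (Suc m - j)) - real (min (Suc j) (m - j))\<bar> \<le> 1"
        using that by (cases "j = 0") (auto simp: min_def split: if_splits)
      ultimately have "\<bar>D\<bar> * real m \<le> 1"
        by (metis abs_mult abs_of_nat)
      then show ?thesis using m by (simp add: field_simps)
    qed
    moreover have "1 / real m \<le> 1" using m by simp
    ultimately have D1: "\<bar>D\<bar> \<le> 1" by linarith
    have prod: "P True j * P False j = ((A + D) * (A - D)) / (2 * real m)\<^sup>2"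
      by (cases a) (simp_all add: P \<sigma>_def power2_eq_square)
    have mean: "(P True j + P False j) / 2 = A / (2 * real m)"
      using m by (cases a) (simp_all add: P \<sigma>_def field_simps)
    have "D\<^sup>2 \<le> (1 / real m)\<^sup>2"
      using D by (metis abs_ge_zero power2_abs power_mono)
    then have "D\<^sup>2 / (2 * real m) \<le> (1 / real m)\<^sup>2 / (2 * real m)"
      by (intro divide_right_mono) auto
    then have "A / (2 * real m) - 1 / (2 * real m ^ 3) \<le> (A - D\<^sup>2) / (2 * real m)"
      by (simp add: diff_divide_distrib power2_eq_square power3_eq_cube)
    also have "\<dots> \<le> sqrt ((A + D) * (A - D)) / (2 * real m)"
      using diff_square_le_sqrt[OF A D1] by (intro divide_right_mono) auto
    also have "\<dots> = sqrt (P True j * P False j)"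
      unfolding prod by (simp only: real_sqrt_divide real_sqrt_abs)
    finally show ?thesis unfolding mean .
  qed
  have one: "(\<Sum>j\<le>m. P b j) = 1" for b
    unfolding P_def using set_signal_tilted_env[OF m] by (intro sum_pmf_eq_1) auto
  \<comment> \<open>Each of the \<open>m + 1\<close> levels loses \<open>1 / (2 * m ^ 3)\<close>,
    and \<open>m + 1 \<le> 2 * m\<close>.\<close>
  have "1 - 1 / (real m)\<^sup>2 \<le> 1 - real (Suc m) / (2 * real m ^ 3)"
    using m by (simp add: field_simps power2_eq_square power3_eq_cube)
  also have "\<dots> = (\<Sum>j\<le>m. (P True j + P False j) / 2 - 1 / (2 * real m ^ 3))"
    by (simp add: sum_subtractf sum.distrib one flip: sum_divide_distrib)
  also have "\<dots> \<le> (\<Sum>j\<le>m. sqrt (P True j * P False j))"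
    using le by (intro sum_mono) auto
  finally show ?thesis unfolding P_def .
qed

section \<open>Lower bound on the minimax regret\<close>

lemma tilted_env_adversaries: "m > 0 \<Longrightarrow> (\<lambda>_. tilted_env m b) \<in> adversaries n"
  using set_tilted_env[of m b] by (auto simp: adversaries_def intro: finite_subset)

text \<open>Against the comparator \<open>\<not> b\<close>, exactly the rounds that play
  \<open>b\<close> cost something, each at least the loss difference.\<close>

lemma regret_tilted_env_ge:
  assumes g: "0 < g" "g < 1" and m: "m > 0" and n: "n > 0"
  shows "g * real m powr (g - 1) / 4 * measure_pmf.expectation
      (history game_signal \<pi> (\<lambda>_. tilted_env m b) n) (\<lambda>h. \<Sum>t<n. of_bool (fst (h ! t) = b))
    \<le> regret (game_loss g) game_signal n \<pi> (\<lambda>_. tilted_env m b)"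
proof -
  let ?e = "\<lambda>a. exp_loss (game_loss g) a (tilted_env m b)"
  let ?H = "history game_signal \<pi> (\<lambda>_. tilted_env m b) n"
  have "measure_pmf.expectation ?H (\<lambda>h. g * real m powr (g - 1) / 4 * (\<Sum>t<n. of_bool (fst (h ! t) = b)))
     \<le> measure_pmf.expectation ?H (\<lambda>h. \<Sum>t<n. ?e (fst (h ! t)) - ?e (\<not> b))"
  proof (rule expectation_mono_finite)
    show "finite (set_pmf ?H)"
      using tilted_env_adversaries[OF m] by (rule finite_set_history[where n = n]) simp
    fix h :: "(bool \<times> nat) list"
    show "g * real m powr (g - 1) / 4 * (\<Sum>t<n. of_bool (fst (h ! t) = b))
        \<le> (\<Sum>t<n. ?e (fst (h ! t)) - ?e (\<not> b))"
      unfolding sum_distrib_left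
    proof (rule sum_mono)
      fix t
      show "g * real m powr (g - 1) / 4 * of_bool (fst (h ! t) = b) \<le> ?e (fst (h ! t)) - ?e (\<not> b)"
        using exp_loss_tilted_env_ge[OF g m, of b]
        by (cases "fst (h ! t) = b") (auto simp: not_iff)
    qed
  qed
  also have "\<dots> \<le> regret (game_loss g) game_signal n \<pi> (\<lambda>_. tilted_env m b)"
    by (intro regret_ge tilted_env_adversaries m n)
  finally show ?thesis by simp
qed

lemma regret_tilted_env_sum_ge:
  assumes g: "0 < g" "g < 1" and m: "m > 0" and n: "n > 0" and nm: "2 * real n \<le> (real m)\<^sup>2"
  shows "g * real m powr (g - 1) / 4 * (real n / 8)
    \<le> regret (game_loss g) game_signal n \<pi> (\<lambda>_. tilted_env m True)
      + regret (game_loss g) game_signal n \<pi> (\<lambda>_. tilted_env m False)"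
proof -
  let ?H = "\<lambda>b. history game_signal \<pi> (\<lambda>_. tilted_env m b) n"
  let ?N = "\<lambda>b h. \<Sum>t<n. of_bool (fst (h ! t) = b) :: real"
  have m2: "1 / (real m)\<^sup>2 \<le> 1" using m by (simp add: divide_le_eq_1)
  \<comment> \<open>Bernoulli's inequality together with \<open>n / m\<^sup>2 \<le> 1 / 2\<close>
    keeps the overlap of the whole interactions above 1/2.\<close>
  have "1 / 2 \<le> 1 + real n * (- (1 / (real m)\<^sup>2))"
    using nm m by (simp add: field_simps)
  also have "\<dots> \<le> (1 + - (1 / (real m)\<^sup>2)) ^ n"
    using m2 by (intro Bernoulli_inequality) simp
  also have "\<dots> = (1 - 1 / (real m)\<^sup>2) ^ n" by simp
  also have "\<dots> \<le> (\<Sum>h\<in>transcripts m n. sqrt (pmf (?H True) h * pmf (?H False) h))"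
    using m2 by (intro history_overlap_ge signal_overlap_ge m) simp
  finally have "real n / 8 \<le> measure_pmf.expectation (?H True) (?N True)
      + measure_pmf.expectation (?H False) (?N False)"
  proof (rule overlap_testing[OF finite_transcripts, rotated -1])
    \<comment> \<open>Every round plays one of the two actions, so the counts of wrong plays in the
      two environments are complementary.\<close>
    show "?N True h + ?N False h = real n" for h :: "(bool \<times> nat) list"
    proof -
      have "of_bool (c = True) + of_bool (c = False) = (1::real)" for c by (cases c) auto
      then show ?thesis by (simp only: sum.distrib[symmetric]) simp
    qed
  qed (auto intro!: set_history_transcripts set_signal_tilted_env m sum_nonneg simp del: set_map_pmf)
  then have "g * real m powr (g - 1) / 4 * (real n / 8)
    \<le> g * real m powr (g - 1) / 4 * (measure_pmf.expectation (?H True) (?N True)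
      + measure_pmf.expectation (?H False) (?N False))"
    using g by (intro mult_left_mono) auto
  also have "\<dots> \<le> regret (game_loss g) game_signal n \<pi> (\<lambda>_. tilted_env m True)
      + regret (game_loss g) game_signal n \<pi> (\<lambda>_. tilted_env m False)"
    unfolding distrib_left by (intro add_mono regret_tilted_env_ge g m n)
  finally show ?thesis .
qed

lemma minimax_regret_game_ge:
  assumes g: "0 < g" "g < 1" and n: "n > 0"
  shows "g / 256 * real n powr ((1 + g) / 2) \<le> minimax_regret (game_loss g) game_signal n"
proof -
  \<comment> \<open>The least \<open>m\<close> with \<open>m\<^sup>2 \<ge> 2 * n\<close>; a larger
    one would shrink the loss difference.\<close>
  define m where "m = nat \<lceil>sqrt (2 * real n)\<rceil>"
  have m: "1 \<le> m" "sqrt (2 * real n) \<le> real m" "real m \<le> 2 * sqrt (2 * real n)"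
    unfolding m_def using n by (intro ceiling_sqrt_bounds; simp)+
  have nm: "2 * real n \<le> (real m)\<^sup>2"
    using m(2) by (simp add: sqrt_le_D)
  have sqrt: "sqrt (real n) = real n powr (1 / 2)" by (simp add: powr_half_sqrt)
  have "sqrt 2 \<le> (2::real)" by (rule real_le_lsqrt) auto
  then have "real m \<le> 4 * sqrt (real n)"
    using m(3) mult_right_mono[of "sqrt 2" 2 "sqrt (real n)"] by (simp add: real_sqrt_mult)
  have "real n powr ((1 + g) / 2) = real n powr 1 * real n powr (1 / 2 * (g - 1))"
    unfolding powr_add[symmetric] by (rule arg_cong[where f = "(powr) (real n)"]) (simp add: field_simps)
  \<comment> \<open>\<open>64 = 4 * 8 * 2\<close> comes from the tent mean, the testing bound and
    the choice of the worse environment; the remaining 4 comes from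
    \<open>m \<le> 4 * sqrt n\<close> and \<open>4 powr (g - 1) \<ge> 1 / 4\<close>.\<close>
  then have "g / 256 * real n powr ((1 + g) / 2)
      = g / 64 * (real n powr 1 * (4 powr - 1 * real n powr (1 / 2 * (g - 1))))"
    by (simp add: powr_minus)
  also have "\<dots> \<le> g / 64 * (real n powr 1 * (4 powr (g - 1) * real n powr (1 / 2 * (g - 1))))"
    using g by (intro mult_left_mono mult_right_mono powr_mono) auto
  also have "\<dots> = g / 64 * (real n * (4 * sqrt (real n)) powr (g - 1))"
    unfolding sqrt by (simp add: powr_mult powr_powr)
  also have "\<dots> \<le> g / 64 * (real n * real m powr (g - 1))"
    using g m \<open>real m \<le> 4 * sqrt (real n)\<close> by (intro mult_left_mono powr_mono2') auto
  finally have le: "g / 256 * real n powr ((1 + g) / 2) \<le> g / 64 * (real n * real m powr (g - 1))" .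
  show ?thesis
  proof (rule minimax_regret_ge)
    fix \<pi>
    define R where "R b = regret (game_loss g) game_signal n \<pi> (\<lambda>_. tilted_env m b)" for b
    have "2 * (g / 256 * real n powr ((1 + g) / 2)) \<le> R True + R False"
      using regret_tilted_env_sum_ge[OF g _ n nm, of \<pi>] le m(1) by (simp add: R_def mult_ac)
    then have "g / 256 * real n powr ((1 + g) / 2) \<le> R True \<or> g / 256 * real n powr ((1 + g) / 2) \<le> R False"
      by linarith
    then obtain b where "g / 256 * real n powr ((1 + g) / 2) \<le> R b"
      by blast
    moreover have "(\<lambda>_. tilted_env m b) \<in> adversaries n"
      using m by (intro tilted_env_adversaries) simp
    ultimately show "\<exists>x\<in>adversaries n. g / 256 * real n powr ((1 + g) / 2)
        \<le> regret (game_loss g) game_signal n \<pi> x"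
      unfolding R_def by blast
  qed (use g n game_loss_bounds in auto)
qed

section \<open>Passage to the limit of the logarithmic ratio\<close>

lemma tendsto_ln_div_ln:
  fixes f :: "nat \<Rightarrow> real"
  assumes c: "0 < c" and f: "\<And>n. n > 0 \<Longrightarrow> c * real n powr q \<le> f n" "\<And>n. n > 0 \<Longrightarrow> f n \<le> C * real n powr q"
  shows "(\<lambda>n. ln (f n) / ln (real n)) \<longlonglongrightarrow> q"
proof -
  have lim: "(\<lambda>n. d / ln (real n) + q) \<longlonglongrightarrow> q" for d :: real
    by (rule tendsto_eq_intros tendsto_divide_0 filterlim_at_top_imp_at_infinity
        filterlim_compose[OF ln_at_top filterlim_real_sequentially] refl | simp)+
  have split: "d / ln (real n) + q = (d + q * ln (real n)) / ln (real n)" if "2 \<le> n" for n d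
    using that by (simp add: add_divide_distrib)
  \<comment> \<open>The case \<open>n = 1\<close> compares the constants and so makes
    \<open>C\<close> positive.\<close>
  have "c \<le> C"
    using f[of 1] by simp
  with c have C: "0 < C" by simp
  \<comment> \<open>For \<open>n \<ge> 2\<close> the divisor \<open>ln n\<close> is positive, and
    the constants only contribute terms that vanish in the limit.\<close>
  have "ln c / ln (real n) + q \<le> ln (f n) / ln (real n)"
    "ln (f n) / ln (real n) \<le> ln C / ln (real n) + q" if n: "2 \<le> n" for n
  proof -
    have pos: "0 < c * real n powr q" using c n by simp
    have fn: "c * real n powr q \<le> f n" "f n \<le> C * real n powr q" using f n by simp_all
    have "ln c + q * ln (real n) = ln (c * real n powr q)"
      "ln C + q * ln (real n) = ln (C * real n powr q)"
      using c C n by (simp_all add: ln_mult_pos ln_powr)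
    moreover have "ln (c * real n powr q) \<le> ln (f n)" "ln (f n) \<le> ln (C * real n powr q)"
      using pos fn by (auto intro!: ln_mono)
    ultimately show "ln c / ln (real n) + q \<le> ln (f n) / ln (real n)"
      "ln (f n) / ln (real n) \<le> ln C / ln (real n) + q"
      unfolding split[OF n] using n by (auto intro!: divide_right_mono)
  qed
  then show ?thesis
    by (intro tendsto_sandwich[OF _ _ lim[of "ln c"] lim[of "ln C"]]
        eventually_sequentiallyI[of 2]) auto
qed

theorem theorem4:
  fixes q :: real
  assumes "1/2 < q" and "q < 1"
  shows "\<exists>(L :: bool \<Rightarrow> nat \<Rightarrow> real) (S :: bool \<Rightarrow> nat \<Rightarrow> nat).
           (\<forall>a z. 0 \<le> L a z \<and> L a z \<le> 1) \<and>
           (\<lambda>n. ln (minimax_regret L S n) / ln (real n)) \<longlonglongrightarrow> q"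
proof (intro exI conjI)
  \<comment> \<open>The range of \<open>q\<close> translates into \<open>0 < g < 1\<close>.\<close>
  define g where "g = 2 * q - 1"
  have g: "0 < g" "g < 1" and q: "q = (1 + g) / 2"
    using assms by (auto simp: g_def)
  show "\<forall>a z. 0 \<le> game_loss g a z \<and> game_loss g a z \<le> 1"
    using game_loss_bounds[of g] g by simp
  show "(\<lambda>n. ln (minimax_regret (game_loss g) game_signal n) / ln (real n)) \<longlonglongrightarrow> q"
    unfolding q using g minimax_regret_game_ge[OF g] minimax_regret_game_le[OF g]
    by (intro tendsto_ln_div_ln[of "g / 256" _ _ 5]) auto
qed

end
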